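(* Let $(X,0)\subset(\mathbb{C}^n,0)$ be an irreducible germ of a Segre nondegenerate $n$-dimensional real-analytic subvariety of Segre multiplicity $k$, and let $\mathcal{R}\colon\mathbb{C}\{\bar z\}\to\mathbb{C}\{z\}$ be its restricted averaging operator. Let $f\in\mathbb{C}\{z\}$ be a germ at $0$ of a holomorphic function. Then $f$ is real-valued on $X$ (as a germ at $0$) if and only if $$\mathcal{R}(\bar f^{\,\ell})=f^\ell\quad\text{for all }\ell=1,\ldots,k.$$
   Context: $\mathbb{C}\{z\}$, $\mathbb{C}\{\bar z\}$, $\mathbb{C}\{z,\bar z\}$ denote the rings of convergent power series, i.e. germs at $0\in\mathbb{C}^n$ of holomorphic, antiholomorphic, respectively complex-valued real-analytic, functions. For $f\in\mathbb{C}\{z\}$, $\bar f\in\mathbb{C}\{\bar z\}$ is the antiholomorphic germ $\bar f(\bar z)=\overline{f(z)}$. "$n$-dimensional" means of real dimension $n$. For a germ $(X,0)\subset(\mathbb{C}^n,0)$ of a real-analytic subvariety, $\mathcal{I}_0(X)\subset\mathbb{C}\{z,\bar z\}$ is the ideal of germs vanishing on $X$. $(X,0)$ is Segre nondegenerate if the ideal $\mathcal{J}=\{\varrho(z,0):\varrho\in\mathcal{I}_0(X)\}\subset\mathbb{C}\{z\}$ satisfies $\mathfrak{m}^s\subset\mathcal{J}$ for some $s\in\mathbb{N}$, $\mathfrak{m}$ being the maximal ideal (equivalently $V(\mathcal{J})=\{0\}$). The complexification $\mathcal{X}$ of $(X,0)$ is the germ at $0$ of the complex subvariety of $\mathbb{C}^n_z\times\mathbb{C}^n_\xi$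 with ideal $\{\varrho(z,\xi):\varrho(z,\bar z)\in\mathcal{I}_0(X)\}$, i.e. the smallest germ of a complex subvariety containing $\{(z,\bar z):z\in X\}$; it has complex dimension $n$. Let $\pi_1(z,\xi)=z$. For suitable arbitrarily small polydiscs $\Delta_z,\Delta_\xi$ centered at $0$, $\mathcal{X}$ is represented by a closed irreducible subvariety of $\Delta_z\times\Delta_\xi$, $\pi_1|_{\mathcal{X}}$ is finite (proper with finite fibers) over $\Delta_z$, $(\pi_1|_{\mathcal{X}})^{-1}(0)=\{0\}$, and for each $z\in\Delta_z$ the fiber $(\pi_1|_{\mathcal{X}})^{-1}(z)$ consists of exactly $k$ points $(z,\xi^1(z)),\dots,(z,\xi^k(z))$ counted with multiplicity (generically distinct). The integer $k$ is the Segre multiplicity of $(X,0)$. The averaging operator $\mathcal{A}\colon\mathbb{C}\{z,\bar z\}\to\mathbb{C}\{z\}$ is $(\mathcal{A}f)(z)=\frac1k\sum_{j=1}^k f(z,\xi^j(z))$, where $f(z,\xi)$ is obtained from $f(z,\bar z)$ by replacing $\bar z$ by $\xi$. The restricted averaging operator is $\mathcal{R}=\mathcal{A}|_{\mathbb{C}\{\bar z\}}\colon\mathbb{C}\{\bar z\}\to\mathbb{C}\{z\}$. *)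

theory Defs
  imports "HOL-Analysis.Analysis"
begin

text \<open>
  Germs at the origin are represented by functions and sets on the whole space; only their
  restrictions to small neighbourhoods of the origin matter, and equality of germs is equality
  \<open>\<forall>\<^sub>F z in nhds 0\<close>.  Points of $\mathbb{C}^n \times \mathbb{C}^n$ are pairs.
  The germ $\varrho(z,\bar z)$ in $\mathbb{C}\{z,\bar z\}$ is represented by the holomorphic germ
  $\varrho(z,\xi)$ at the origin of $\mathbb{C}^n \times \mathbb{C}^n$ with the same power series,
  and likewise $g(\bar z)$ in $\mathbb{C}\{\bar z\}$ by the holomorphic germ $g(\xi)$.
\<close>

text \<open>
  The parameter \<open>sc\<close> is the multiplication by complex scalars on the domain: the library has no
  class of complex vector spaces covering both $\mathbb{C}^n$ and $\mathbb{C}^n \times \mathbb{C}^n$.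
\<close>

definition scale2 :: "complex \<Rightarrow> (complex^'n) \<times> (complex^'n) \<Rightarrow> (complex^'n) \<times> (complex^'n)" where
  "scale2 c p = (c *s fst p, c *s snd p)"

definition holo_on ::
    "(complex \<Rightarrow> 'a \<Rightarrow> 'a) \<Rightarrow> ('a::real_normed_vector \<Rightarrow> complex) \<Rightarrow> 'a set \<Rightarrow> bool" where
  "holo_on sc f U \<longleftrightarrow> open U \<and>
     (\<forall>p\<in>U. \<exists>D. (f has_derivative D) (at p) \<and> (\<forall>c v. D (sc c v) = c * D v))"

definition holo_germ ::
    "(complex \<Rightarrow> 'a \<Rightarrow> 'a) \<Rightarrow> ('a::real_normed_vector \<Rightarrow> complex) \<Rightarrow> bool" where
  "holo_germ sc f \<longleftrightarrow> (\<exists>U. 0 \<in> U \<and> holo_on sc f U)"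

definition analytic_subset ::
    "(complex \<Rightarrow> 'a \<Rightarrow> 'a) \<Rightarrow> 'a::real_normed_vector set \<Rightarrow> 'a set \<Rightarrow> bool" where
  "analytic_subset sc \<Omega> A \<longleftrightarrow> A \<subseteq> \<Omega> \<and>
     (\<forall>p\<in>\<Omega>. \<exists>W \<Phi>. p \<in> W \<and> W \<subseteq> \<Omega> \<and> open W \<and> finite \<Phi> \<and> (\<forall>\<phi>\<in>\<Phi>. holo_on sc \<phi> W) \<and>
        A \<inter> W = {q\<in>W. \<forall>\<phi>\<in>\<Phi>. \<phi> q = 0})"

definition irreducible_analytic_subset ::
    "(complex \<Rightarrow> 'a \<Rightarrow> 'a) \<Rightarrow> 'a::real_normed_vector set \<Rightarrow> 'a set \<Rightarrow> bool" where
  "irreducible_analytic_subset sc \<Omega> A \<longleftrightarrow> analytic_subset sc \<Omega> A \<and> A \<noteq> {} \<and>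
     (\<forall>B C. analytic_subset sc \<Omega> B \<and> analytic_subset sc \<Omega> C \<and> A = B \<union> C \<longrightarrow> A = B \<or> A = C)"

definition cnjv :: "complex^'n \<Rightarrow> complex^'n" where
  "cnjv z = (\<chi> i. cnj (z $ i))"

text \<open>
  Complex-valued real-analytic functions: near each point $p$ a convergent power series in
  $z - p$ and $\bar z - \bar p$, that is, $F(z,\bar z)$ with $F$ holomorphic near $(p,\bar p)$.
\<close>

definition real_analytic_fun_on :: "(complex^'n \<Rightarrow> complex) \<Rightarrow> (complex^'n) set \<Rightarrow> bool" where
  "real_analytic_fun_on \<phi> W \<longleftrightarrow> open W \<and>
     (\<forall>p\<in>W. \<exists>F U. (p, cnjv p) \<in> U \<and> holo_on scale2 F U \<and>
        (\<forall>\<^sub>F z in nhds p. \<phi> z = F (z, cnjv z)))"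

definition real_subvariety_germ :: "(complex^'n) set \<Rightarrow> bool" where
  "real_subvariety_germ X \<longleftrightarrow> 0 \<in> X \<and>
     (\<exists>U \<Phi>. 0 \<in> U \<and> open U \<and> finite \<Phi> \<and> (\<forall>\<phi>\<in>\<Phi>. real_analytic_fun_on \<phi> U) \<and>
        X \<inter> U = {z\<in>U. \<forall>\<phi>\<in>\<Phi>. \<phi> z = 0})"

definition irreducible_germ :: "(complex^'n) set \<Rightarrow> bool" where
  "irreducible_germ X \<longleftrightarrow> real_subvariety_germ X \<and>
     (\<forall>A B. real_subvariety_germ A \<and> real_subvariety_germ B \<and>
        (\<forall>\<^sub>F z in nhds 0. z \<in> X \<longleftrightarrow> z \<in> A \<union> B) \<longrightarrow>
        (\<forall>\<^sub>F z in nhds 0. z \<in> X \<longleftrightarrow> z \<in> A) \<or> (\<forall>\<^sub>F z in nhds 0. z \<in> X \<longleftrightarrow> z \<in> B))"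

text \<open>
  Near $p$, the set \<open>X\<close> is a real-analytic submanifold of real dimension \<open>d\<close>, given by
  $m = 2n - d$ real-valued equations with differentials linearly independent over the reals.
\<close>

definition regular_point :: "nat \<Rightarrow> (complex^'n) set \<Rightarrow> complex^'n \<Rightarrow> bool" where
  "regular_point d X p \<longleftrightarrow> p \<in> X \<and>
     (\<exists>m W. \<exists>\<rho> :: nat \<Rightarrow> complex^'n \<Rightarrow> real.
        d + m = 2 * CARD('n) \<and> p \<in> W \<and> open W \<and>
        (\<forall>i<m. real_analytic_fun_on (\<lambda>z. complex_of_real (\<rho> i z)) W) \<and>
        X \<inter> W = {z\<in>W. \<forall>i<m. \<rho> i z = 0} \<and>
        (\<forall>c :: nat \<Rightarrow> real. (\<forall>v. (\<Sum>i<m. c i * frechet_derivative (\<rho> i) (at p) v) = 0) \<longrightarrow>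
           (\<forall>i<m. c i = 0)))"

definition germ_dimension :: "(complex^'n) set \<Rightarrow> nat \<Rightarrow> bool" where
  "germ_dimension X d \<longleftrightarrow>
     (\<forall>\<epsilon>>0. \<exists>p\<in>ball 0 \<epsilon>. regular_point d X p) \<and>
     (\<forall>d'>d. \<exists>\<epsilon>>0. \<forall>p\<in>ball 0 \<epsilon>. \<not> regular_point d' X p)"

definition vanishing_ideal :: "(complex^'n) set \<Rightarrow> ((complex^'n) \<times> (complex^'n) \<Rightarrow> complex) set" where
  "vanishing_ideal X =
     {\<rho>. holo_germ scale2 \<rho> \<and> (\<forall>\<^sub>F z in nhds 0. z \<in> X \<longrightarrow> \<rho> (z, cnjv z) = 0)}"

definition segre_ideal :: "(complex^'n) set \<Rightarrow> (complex^'n \<Rightarrow> complex) set" where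
  "segre_ideal X = {h. \<exists>\<rho>\<in>vanishing_ideal X. \<forall>\<^sub>F z in nhds 0. h z = \<rho> (z, 0)}"

definition max_ideal :: "(complex^'n \<Rightarrow> complex) set" where
  "max_ideal = {g. holo_germ (*s) g \<and> g 0 = 0}"

definition max_ideal_power :: "nat \<Rightarrow> (complex^'n \<Rightarrow> complex) set" where
  "max_ideal_power s =
     {h. \<exists>N. \<exists>c :: nat \<Rightarrow> complex^'n \<Rightarrow> complex. \<exists>g :: nat \<Rightarrow> nat \<Rightarrow> complex^'n \<Rightarrow> complex.
        (\<forall>i<N. holo_germ (*s) (c i) \<and> (\<forall>j<s. g i j \<in> max_ideal)) \<and>
        (\<forall>\<^sub>F z in nhds 0. h z = (\<Sum>i<N. c i z * (\<Prod>j<s. g i j z)))}"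

definition segre_nondegenerate :: "(complex^'n) set \<Rightarrow> bool" where
  "segre_nondegenerate X \<longleftrightarrow> (\<exists>s. max_ideal_power s \<subseteq> segre_ideal X)"

text \<open>
  The germ of \<open>V\<close> at the origin is complex-analytic and its ideal is the complexified ideal of \<open>X\<close>.
\<close>

definition is_complexification ::
    "(complex^'n) set \<Rightarrow> ((complex^'n) \<times> (complex^'n)) set \<Rightarrow> bool" where
  "is_complexification X V \<longleftrightarrow>
     (\<exists>U. 0 \<in> U \<and> open U \<and> analytic_subset scale2 U (V \<inter> U)) \<and>
     {\<rho>. holo_germ scale2 \<rho> \<and> (\<forall>\<^sub>F p in nhds 0. p \<in> V \<longrightarrow> \<rho> p = 0)} = vanishing_ideal X"

definition polydisc :: "('n \<Rightarrow> real) \<Rightarrow> (complex^'n) set" where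
  "polydisc r = {z. \<forall>i. cmod (z $ i) < r i}"

definition fiber :: "((complex^'n) \<times> (complex^'n)) set \<Rightarrow> complex^'n \<Rightarrow> (complex^'n) set" where
  "fiber V z = {\<xi>. (z, \<xi>) \<in> V}"

text \<open>
  The multiplicity \<open>m\<close> of a point $(z_0,\xi_0)$ of \<open>V\<close> in its fiber over $z_0$ is the local number
  of sheets of the projection: for small \<open>\<epsilon>\<close>, the generic fiber over points near $z_0$ has exactly
  \<open>m\<close> points in the \<open>\<epsilon>\<close>-ball around $\xi_0$.  Generic means off a proper analytic subset.
\<close>

definition fiber_multiplicity ::
    "((complex^'n) \<times> (complex^'n)) set \<Rightarrow> complex^'n \<Rightarrow> complex^'n \<Rightarrow> nat \<Rightarrow> bool" where
  "fiber_multiplicity V z\<^sub>0 \<xi>\<^sub>0 m \<longleftrightarrow>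
     (\<exists>\<epsilon>\<^sub>0>0. \<forall>\<epsilon>. 0 < \<epsilon> \<and> \<epsilon> \<le> \<epsilon>\<^sub>0 \<longrightarrow>
        (\<exists>\<delta>>0. \<exists>D. analytic_subset (*s) (ball z\<^sub>0 \<delta>) D \<and> D \<noteq> ball z\<^sub>0 \<delta> \<and>
           (\<forall>z\<in>ball z\<^sub>0 \<delta> - D. finite (fiber V z \<inter> ball \<xi>\<^sub>0 \<epsilon>) \<and>
              card (fiber V z \<inter> ball \<xi>\<^sub>0 \<epsilon>) = m)))"

text \<open>
  Over the polydisc of polyradius \<open>r\<close>, the fiber of \<open>V\<close> over \<open>z\<close> consists of the points
  \<open>\<xi> 1 z, \<dots>, \<xi> k z\<close>, each listed as often as its multiplicity.
\<close>

definition segre_representative ::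
    "(complex^'n) set \<Rightarrow> nat \<Rightarrow> ('n \<Rightarrow> real) \<Rightarrow> ('n \<Rightarrow> real) \<Rightarrow>
     ((complex^'n) \<times> (complex^'n)) set \<Rightarrow> (nat \<Rightarrow> complex^'n \<Rightarrow> complex^'n) \<Rightarrow> bool" where
  "segre_representative X k r r' V \<xi> \<longleftrightarrow>
     (\<forall>i. 0 < r i \<and> 0 < r' i) \<and>
     is_complexification X V \<and>
     irreducible_analytic_subset scale2 (polydisc r \<times> polydisc r') V \<and>
     proper_map (top_of_set V) (top_of_set (polydisc r)) fst \<and>
     (\<forall>z\<in>polydisc r. finite (fiber V z)) \<and>
     fiber V 0 = {0} \<and>
     (\<forall>z\<in>polydisc r. fiber V z = (\<lambda>j. \<xi> j z) ` {1..k} \<and>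
        (\<forall>p\<in>fiber V z. fiber_multiplicity V z p (card {j\<in>{1..k}. \<xi> j z = p}))) \<and>
     (\<exists>D. analytic_subset (*s) (polydisc r) D \<and> D \<noteq> polydisc r \<and>
        (\<forall>z\<in>polydisc r - D. inj_on (\<lambda>j. \<xi> j z) {1..k}))"

definition has_segre_multiplicity :: "(complex^'n) set \<Rightarrow> nat \<Rightarrow> bool" where
  "has_segre_multiplicity X k \<longleftrightarrow>
     (\<forall>\<epsilon>>0. \<exists>r r' V \<xi>. polydisc r \<subseteq> ball 0 \<epsilon> \<and> polydisc r' \<subseteq> ball 0 \<epsilon> \<and>
        segre_representative X k r r' V \<xi>)"

text \<open>
  Two representatives give the same unordered tuple $\xi^1(z),\dots,\xi^k(z)$ for all \<open>z\<close> near the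
  origin, so the choice made here does not affect the germ of the average.
\<close>

definition segre_points :: "(complex^'n) set \<Rightarrow> nat \<Rightarrow> nat \<Rightarrow> complex^'n \<Rightarrow> complex^'n" where
  "segre_points X k = (SOME \<xi>. \<exists>r r' V. segre_representative X k r r' V \<xi>)"

definition averaging ::
    "(complex^'n) set \<Rightarrow> nat \<Rightarrow> ((complex^'n) \<times> (complex^'n) \<Rightarrow> complex) \<Rightarrow> complex^'n \<Rightarrow> complex" where
  "averaging X k F z = (1 / of_nat k) * (\<Sum>j=1..k. F (z, segre_points X k j z))"

definition restricted_averaging ::
    "(complex^'n) set \<Rightarrow> nat \<Rightarrow> (complex^'n \<Rightarrow> complex) \<Rightarrow> complex^'n \<Rightarrow> complex" where
  "restricted_averaging X k g = averaging X k (\<lambda>(z, \<xi>). g \<xi>)"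

definition bar_germ :: "(complex^'n \<Rightarrow> complex) \<Rightarrow> complex^'n \<Rightarrow> complex" where
  "bar_germ f \<xi> = cnj (f (cnjv \<xi>))"

end

theory Submission
  imports Defs
begin

text \<open>
  The whole statement is about the single germ $\varrho(z,\xi) = f(z) - \bar f(\xi)$.  On the points
  $(z,\bar z)$ it equals $f(z) - \overline{f(z)}$, so \<open>f\<close> is real-valued on \<open>X\<close> exactly when
  \<open>\<rho>\<close> lies in the ideal of \<open>X\<close> (\<open>real_on_iff_reality_defect_in_vanishing_ideal\<close>).  That ideal is
  the ideal of the complexification \<open>V\<close>, so the condition says $\bar f(\xi) = f(z)$ at all points
  $(z,\xi)$ of \<open>V\<close> near the origin.

  Since \<open>V\<close> is proper over the \<open>z\<close>-space and its fiber over the origin is the origin alone, the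
  points $\xi^1(z),\dots,\xi^k(z)$ tend to the origin with \<open>z\<close> (\<open>proper_projection_fiber_near_origin\<close>).
  Hence the condition becomes $\bar f(\xi^j(z)) = f(z)$ for all \<open>j\<close> and all small \<open>z\<close>.  Averaging
  the powers of these equations gives one implication.  For the other, the hypothesis says that the
  \<open>k\<close> numbers $\bar f(\xi^j(z))$ have the same first \<open>k\<close> power sums as \<open>k\<close> copies of the
  number $f(z)$, and \<open>k\<close> power sums determine \<open>k\<close> numbers up to order
  (\<open>power_sums_of_constant\<close> is the case needed here).
\<close>

section \<open>Power sums\<close>

text \<open>
  Linearity carries the equality of power sums over to the sums of $P(w_j)$ for every polynomial
  \<open>P\<close> of degree at most \<open>k\<close>.  If some value \<open>v\<close> of \<open>w\<close> differed from \<open>c\<close>, the polynomial whose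
  roots are \<open>c\<close> and the values of \<open>w\<close> other than \<open>v\<close> would have degree at most \<open>k\<close>, but sum to a nonzero
  multiple of $P(v)$ instead of to $k P(c) = 0$.
\<close>

lemma power_sums_of_constant:
  fixes w :: "'b \<Rightarrow> 'a::field_char_0"
  assumes fin: "finite J"
    and sums: "\<And>l. 1 \<le> l \<Longrightarrow> l \<le> card J \<Longrightarrow> (\<Sum>j\<in>J. w j ^ l) = of_nat (card J) * c ^ l"
    and i: "i \<in> J"
  shows "w i = c"
proof (rule ccontr)
  assume ne: "w i \<noteq> c"
  have sums0: "(\<Sum>j\<in>J. w j ^ l) = of_nat (card J) * c ^ l" if "l \<le> card J" for l
    using sums[of l] that by (cases "l = 0") auto
  define S where "S = insert c (w ` J) - {w i}"
  define P where "P = (\<Prod>s\<in>S. [:- s, 1:])"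
  have "card S = card (insert c (w ` J)) - 1"
    unfolding S_def using fin i by (subst card_Diff_singleton) auto
  moreover have "card (insert c (w ` J)) \<le> Suc (card J)"
    using fin card_image_le[OF fin, of w] card_insert_le_m1[of "Suc (card J)" "w ` J" c] by simp
  ultimately have "card S \<le> card J" by simp
  moreover have "degree P \<le> card S"
    unfolding P_def by (rule order_trans[OF degree_prod_sum_le]) (auto simp: S_def fin)
  ultimately have deg: "degree P \<le> card J" by simp
  have finS: "finite S" by (simp add: S_def fin)
  have poly_P: "poly P x = (\<Prod>s\<in>S. x - s)" for x
    unfolding P_def by (simp add: poly_prod)
  have "(\<Sum>j\<in>J. poly P (w j)) = (\<Sum>l\<le>degree P. coeff P l * (\<Sum>j\<in>J. w j ^ l))"
    unfolding poly_altdef by (subst sum.swap) (simp add: sum_distrib_left)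
  also have "\<dots> = (\<Sum>l\<le>degree P. coeff P l * (of_nat (card J) * c ^ l))"
    by (rule sum.cong) (use deg in \<open>auto simp: sums0\<close>)
  also have "\<dots> = of_nat (card J) * poly P c"
    by (simp add: poly_altdef sum_distrib_left mult_ac)
  also have "poly P c = 0"
    unfolding poly_P using finS ne by (intro prod_zero) (auto simp: S_def)
  finally have total: "(\<Sum>j\<in>J. poly P (w j)) = 0" by simp
  have "poly P (w j) = (if w j = w i then poly P (w i) else 0)" if "j \<in> J" for j
  proof (cases "w j = w i")
    case False
    then have "w j \<in> S" using that by (auto simp: S_def)
    then show ?thesis using False finS unfolding poly_P by (auto intro!: prod_zero)
  qed auto
  then have "(\<Sum>j\<in>J. poly P (w j)) = (\<Sum>j\<in>J. if w j = w i then poly P (w i) else 0)"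
    by (rule sum.cong[OF refl])
  also have "\<dots> = of_nat (card {j\<in>J. w j = w i}) * poly P (w i)"
    by (simp add: sum.inter_filter[OF fin, symmetric])
  finally have "of_nat (card {j\<in>J. w j = w i}) * poly P (w i) = 0"
    using total by simp
  moreover have "card {j\<in>J. w j = w i} \<noteq> 0"
    using fin i by auto
  moreover have "poly P (w i) \<noteq> 0"
    unfolding poly_P using finS by (auto simp: S_def)
  ultimately show False by simp
qed

section \<open>The germ whose vanishing means that a function is real\<close>

lemma cnjv_cnjv [simp]: "cnjv (cnjv z) = z"
  by (simp add: cnjv_def vec_eq_iff)

lemma cnjv_0 [simp]: "cnjv 0 = 0"
  by (simp add: cnjv_def vec_eq_iff)

lemma cnjv_scale: "cnjv (c *s z) = cnj c *s cnjv z"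
  by (simp add: cnjv_def vec_eq_iff)

lemma bounded_linear_cnjv: "bounded_linear (cnjv :: complex^'n \<Rightarrow> complex^'n)"
  by (rule linear_conv_bounded_linear[THEN iffD1])
    (auto intro!: linearI simp: cnjv_def vec_eq_iff)

lemma continuous_on_cnjv: "continuous_on S cnjv"
  using bounded_linear_cnjv by (rule linear_continuous_on)

definition reality_defect ::
    "(complex^'n \<Rightarrow> complex) \<Rightarrow> (complex^'n) \<times> (complex^'n) \<Rightarrow> complex" where
  "reality_defect f p = f (fst p) - bar_germ f (snd p)"

text \<open>
  The derivative of $\bar f$ is obtained from that of \<open>f\<close> by conjugating both argument and value, and
  the two conjugations together leave it complex linear.
\<close>

lemma holo_germ_reality_defect:
  assumes "holo_germ (*s) f"
  shows "holo_germ scale2 (reality_defect f)"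
proof -
  obtain U where "0 \<in> U" and U: "holo_on (*s) f U"
    using assms by (auto simp: holo_germ_def)
  have "open U"
    using U by (simp add: holo_on_def)
  let ?W = "U \<times> (cnjv -` U)"
  have "\<exists>D. (reality_defect f has_derivative D) (at p) \<and> (\<forall>c v. D (scale2 c v) = c * D v)"
    if "p \<in> ?W" for p
  proof -
    have "fst p \<in> U" "cnjv (snd p) \<in> U" using that by auto
    then obtain D E where
      D: "(f has_derivative D) (at (fst p))" "\<And>c v. D (c *s v) = c * D v" and
      E: "(f has_derivative E) (at (cnjv (snd p)))" "\<And>c v. E (c *s v) = c * E v"
      using U unfolding holo_on_def by blast
    have 1: "((\<lambda>p. f (fst p)) has_derivative (\<lambda>v. D (fst v))) (at p)"
      by (rule has_derivative_compose[OF has_derivative_fst[OF has_derivative_ident] D(1)])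
    have "((\<lambda>p. cnjv (snd p)) has_derivative (\<lambda>v. cnjv (snd v))) (at p)"
      by (rule bounded_linear.has_derivative[OF bounded_linear_cnjv
            has_derivative_snd[OF has_derivative_ident]])
    then have "((\<lambda>p. f (cnjv (snd p))) has_derivative (\<lambda>v. E (cnjv (snd v)))) (at p)"
      using E(1) by (rule has_derivative_compose)
    then have 2: "((\<lambda>p. bar_germ f (snd p)) has_derivative (\<lambda>v. cnj (E (cnjv (snd v))))) (at p)"
      unfolding bar_germ_def by (rule has_derivative_cnj)
    have "(reality_defect f has_derivative (\<lambda>v. D (fst v) - cnj (E (cnjv (snd v))))) (at p)"
      unfolding reality_defect_def[abs_def] by (rule has_derivative_diff[OF 1 2])
    moreover have "\<forall>c v. D (fst (scale2 c v)) - cnj (E (cnjv (snd (scale2 c v))))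
        = c * (D (fst v) - cnj (E (cnjv (snd v))))"
      by (simp add: scale2_def D(2) E(2) cnjv_scale algebra_simps)
    ultimately show ?thesis by blast
  qed
  moreover have "open ?W"
    using \<open>open U\<close> by (intro open_Times open_vimage continuous_on_cnjv)
  moreover have "0 \<in> ?W"
    using \<open>0 \<in> U\<close> by (simp add: zero_prod_def)
  ultimately show ?thesis
    unfolding holo_germ_def holo_on_def by (intro exI[of _ ?W] conjI ballI)
qed

lemma real_on_iff_reality_defect_in_vanishing_ideal:
  assumes "holo_germ (*s) f"
  shows "(\<forall>\<^sub>F z in nhds 0. z \<in> X \<longrightarrow> f z \<in> \<real>) \<longleftrightarrow> reality_defect f \<in> vanishing_ideal X"
proof -
  have "reality_defect f (z, cnjv z) = 0 \<longleftrightarrow> f z \<in> \<real>" for z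
    by (auto simp: reality_defect_def bar_germ_def Reals_cnj_iff)
  then show ?thesis
    using holo_germ_reality_defect[OF assms] by (simp add: vanishing_ideal_def)
qed

section \<open>The sheets of the complexification near the origin\<close>

lemma eventually_nhds_in_polydisc:
  fixes r :: "'n::finite \<Rightarrow> real"
  assumes "\<And>i. 0 < r i"
  shows "\<forall>\<^sub>F z in nhds 0. z \<in> polydisc r"
proof -
  have "\<forall>\<^sub>F z in nhds (0::complex^'n). cmod (z $ i) < r i" for i
  proof -
    have "open {z::complex^'n. cmod (z $ i) < r i}"
      by (intro open_Collect_less continuous_intros)
    then show ?thesis
      using assms eventually_nhds_in_open[of "{z::complex^'n. cmod (z $ i) < r i}" 0] by simp
  qed
  then show ?thesis
    unfolding polydisc_def by (simp add: eventually_all_finite)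
qed

text \<open>
  A proper map is closed, so the part of \<open>V\<close> outside a neighbourhood \<open>W\<close> of the origin has a closed
  image, which misses the origin because the only point of \<open>V\<close> above it lies in \<open>W\<close>.
\<close>

lemma proper_projection_fiber_near_origin:
  fixes V :: "((complex^'n) \<times> (complex^'n)) set"
  assumes proper: "proper_map (top_of_set V) (top_of_set P) fst"
    and P: "\<forall>\<^sub>F z in nhds 0. z \<in> P"
    and fiber0: "fiber V 0 = {0}"
    and W: "\<forall>\<^sub>F p in nhds 0. p \<in> W"
  shows "\<forall>\<^sub>F z in nhds 0. \<forall>\<xi>\<in>fiber V z. (z, \<xi>) \<in> W"
proof -
  obtain W' where W': "open W'" "0 \<in> W'" "W' \<subseteq> W"
    using W by (auto simp: eventually_nhds)
  have "closedin (top_of_set V) (V - W')"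
    using closedin_closed_Int[of "- W'" V] W'(1) by (simp add: Diff_eq closed_Compl)
  then have "closedin (top_of_set P) (fst ` (V - W'))"
    using proper by (simp add: proper_map_def closed_map_def)
  then obtain C where C: "closed C" "fst ` (V - W') = P \<inter> C"
    by (auto simp: closedin_closed)
  have "\<zeta> = 0" if "(0, \<zeta>) \<in> V" for \<zeta>
    using fiber0 that unfolding fiber_def by blast
  then have "0 \<notin> fst ` (V - W')"
    using W'(2) unfolding zero_prod_def by force
  moreover have "0 \<in> P"
    using P by (rule eventually_nhds_x_imp_x)
  ultimately have "0 \<in> - C" using C(2) by blast
  with C(1) have "\<forall>\<^sub>F z in nhds 0. z \<in> - C"
    by (intro eventually_nhds_in_open) auto
  with P show ?thesis
  proof eventually_elim
    case (elim z)
    then have "z \<notin> fst ` (V - W')" using C(2) by blast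
    then have "(z, \<zeta>) \<in> W" if "(z, \<zeta>) \<in> V" for \<zeta>
      using that W'(3) by (metis DiffI fst_conv image_eqI subsetD)
    then show ?case by (simp add: fiber_def)
  qed
qed

lemma segre_points_representative:
  assumes "has_segre_multiplicity X k"
  obtains r r' V where "segre_representative X k r r' V (segre_points X k)"
proof -
  have "\<exists>\<xi> r r' V. segre_representative X k r r' V \<xi>"
    using assms unfolding has_segre_multiplicity_def by (meson zero_less_one)
  then show ?thesis
    using that someI_ex[of "\<lambda>\<xi>. \<exists>r r' V. segre_representative X k r r' V \<xi>"]
    unfolding segre_points_def by blast
qed

text \<open>
  The ideal of \<open>X\<close> is that of \<open>V\<close>, so this compares germs at the origin of the product space with
  germs at the origin of the base.  Properness of \<open>V\<close> gives the passage to the base, as all points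
  of \<open>V\<close> over a small \<open>z\<close> are small; the converse needs only the continuity of the projection.
\<close>

lemma reality_defect_in_vanishing_ideal_iff:
  fixes X :: "(complex^'n) set"
  assumes rep: "segre_representative X k r r' V \<xi>"
    and f: "holo_germ (*s) f"
  shows "reality_defect f \<in> vanishing_ideal X \<longleftrightarrow>
    (\<forall>\<^sub>F z in nhds 0. \<forall>j\<in>{1..k}. bar_germ f (\<xi> j z) = f z)"
proof -
  have P: "\<forall>\<^sub>F z in nhds 0. z \<in> polydisc r"
    using rep by (intro eventually_nhds_in_polydisc) (simp add: segre_representative_def)
  have fib: "fiber V z = (\<lambda>j. \<xi> j z) ` {1..k}" if "z \<in> polydisc r" for z
    using rep that by (simp add: segre_representative_def)
  have "is_complexification X V"
    using rep by (simp add: segre_representative_def)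
  then have "reality_defect f \<in> vanishing_ideal X \<longleftrightarrow>
      (\<forall>\<^sub>F p in nhds 0. p \<in> V \<longrightarrow> reality_defect f p = 0)"
    using holo_germ_reality_defect[OF f] unfolding is_complexification_def by blast
  also have "\<dots> \<longleftrightarrow> (\<forall>\<^sub>F z in nhds 0. \<forall>j\<in>{1..k}. bar_germ f (\<xi> j z) = f z)"
  proof
    assume "\<forall>\<^sub>F p in nhds 0. p \<in> V \<longrightarrow> reality_defect f p = 0"
    then have "\<forall>\<^sub>F p in nhds 0. p \<in> {p. p \<in> V \<longrightarrow> reality_defect f p = 0}" by simp
    then have "\<forall>\<^sub>F z in nhds 0. \<forall>\<zeta>\<in>fiber V z. (z, \<zeta>) \<in> {p. p \<in> V \<longrightarrow> reality_defect f p = 0}"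
      using rep P
      by (intro proper_projection_fiber_near_origin[where P = "polydisc r"])
        (auto simp: segre_representative_def)
    with P show "\<forall>\<^sub>F z in nhds 0. \<forall>j\<in>{1..k}. bar_germ f (\<xi> j z) = f z"
    proof eventually_elim
      case (elim z)
      show ?case
      proof
        fix j assume "j \<in> {1..k}"
        then have "\<xi> j z \<in> fiber V z" using fib[OF elim(1)] by blast
        then show "bar_germ f (\<xi> j z) = f z"
          using elim(2) by (auto simp: fiber_def reality_defect_def)
      qed
    qed
  next
    assume "\<forall>\<^sub>F z in nhds 0. \<forall>j\<in>{1..k}. bar_germ f (\<xi> j z) = f z"
    with P have "\<forall>\<^sub>F z in nhds 0. z \<in> polydisc r \<and> (\<forall>j\<in>{1..k}. bar_germ f (\<xi> j z) = f z)"
      by eventually_elim simp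
    moreover have "filterlim fst (nhds 0) (nhds (0 :: (complex^'n) \<times> (complex^'n)))"
      using tendsto_fst[OF filterlim_ident, of "0 :: (complex^'n) \<times> (complex^'n)"] by simp
    ultimately have "\<forall>\<^sub>F p in nhds (0 :: (complex^'n) \<times> (complex^'n)).
        fst p \<in> polydisc r \<and> (\<forall>j\<in>{1..k}. bar_germ f (\<xi> j (fst p)) = f (fst p))"
      by (rule eventually_compose_filterlim)
    then show "\<forall>\<^sub>F p in nhds 0. p \<in> V \<longrightarrow> reality_defect f p = 0"
    proof eventually_elim
      case (elim p)
      show ?case
      proof
        assume "p \<in> V"
        then have "snd p \<in> fiber V (fst p)" by (simp add: fiber_def)
        then show "reality_defect f p = 0"
          using elim fib by (auto simp: reality_defect_def)
      qed
    qed
  qed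
  finally show ?thesis .
qed

section \<open>Real-valued germs and averages of powers\<close>

lemma averages_of_powers_eq_iff:
  fixes w :: "nat \<Rightarrow> 'a::field_char_0"
  assumes "k \<noteq> 0"
  shows "(\<forall>l\<in>{1..k}. 1 / of_nat k * (\<Sum>j=1..k. w j ^ l) = c ^ l) \<longleftrightarrow> (\<forall>j\<in>{1..k}. w j = c)"
proof
  assume "\<forall>l\<in>{1..k}. 1 / of_nat k * (\<Sum>j=1..k. w j ^ l) = c ^ l"
  then have "(\<Sum>j=1..k. w j ^ l) = of_nat (card {1..k}) * c ^ l" if "1 \<le> l" "l \<le> card {1..k}" for l
    using assms that by (force simp: field_simps)
  then show "\<forall>j\<in>{1..k}. w j = c"
    using power_sums_of_constant[of "{1..k}" w c] by blast
qed (use assms in simp)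

theorem theorem5p1:
  fixes X :: "(complex^'n) set" and k :: nat and f :: "complex^'n \<Rightarrow> complex"
  assumes "irreducible_germ X"
    and "germ_dimension X CARD('n)"
    and "segre_nondegenerate X"
    and "has_segre_multiplicity X k"
    and "holo_germ (*s) f"
  shows "(\<forall>\<^sub>F z in nhds 0. z \<in> X \<longrightarrow> f z \<in> \<real>) \<longleftrightarrow>
         (\<forall>l\<in>{1..k}. \<forall>\<^sub>F z in nhds 0.
            restricted_averaging X k (\<lambda>\<xi>. bar_germ f \<xi> ^ l) z = f z ^ l)"
proof -
  obtain r r' V where rep: "segre_representative X k r r' V (segre_points X k)"
    using assms(4) by (rule segre_points_representative)
  then have "(0 :: complex^'n) \<in> polydisc r" "fiber V 0 = {0}"
    by (auto simp: segre_representative_def polydisc_def)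
  \<comment> \<open>For $k = 0$ the averages would be $0$; the point of \<open>V\<close> over the origin excludes this.\<close>
  with rep have "{0} = (\<lambda>j. segre_points X k j 0) ` {1..k}"
    unfolding segre_representative_def by simp
  then have "k \<noteq> 0" by auto
  have "(\<forall>\<^sub>F z in nhds 0. z \<in> X \<longrightarrow> f z \<in> \<real>) \<longleftrightarrow>
      (\<forall>\<^sub>F z in nhds 0. \<forall>j\<in>{1..k}. bar_germ f (segre_points X k j z) = f z)"
    using real_on_iff_reality_defect_in_vanishing_ideal[OF assms(5)]
      reality_defect_in_vanishing_ideal_iff[OF rep assms(5)] by simp
  also have "\<dots> \<longleftrightarrow> (\<forall>\<^sub>F z in nhds 0. \<forall>l\<in>{1..k}.
      restricted_averaging X k (\<lambda>\<xi>. bar_germ f \<xi> ^ l) z = f z ^ l)"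
    by (simp only: restricted_averaging_def averaging_def prod.case
        averages_of_powers_eq_iff[OF \<open>k \<noteq> 0\<close>])
  also have "\<dots> \<longleftrightarrow> (\<forall>l\<in>{1..k}. \<forall>\<^sub>F z in nhds 0.
      restricted_averaging X k (\<lambda>\<xi>. bar_germ f \<xi> ^ l) z = f z ^ l)"
    by (simp add: eventually_ball_finite_distrib)
  finally show ?thesis .
qed

end
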